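(* A diversity $(X,\delta)$ is injective if and only if it is hyperconvex.
   Context: For a set $X$, $\mathcal{P}_{\mathrm{fin}}(X)$ denotes the set of all finite subsets of $X$. A diversity is a pair $(X,\delta)$ where $X$ is a set and $\delta:\mathcal{P}_{\mathrm{fin}}(X)\to\mathbb{R}$ satisfies, for all finite $A,B,C\subseteq X$: (D1) $\delta(A)\ge 0$, and $\delta(A)=0$ if and only if $|A|\le 1$; (D2) if $B\ne\emptyset$ then $\delta(A\cup C)\le\delta(A\cup B)+\delta(B\cup C)$. Given diversities $(Y_1,\delta_1)$ and $(Y_2,\delta_2)$, a map $\phi:Y_1\to Y_2$ is non-expansive if $\delta_1(A)\ge\delta_2(\phi(A))$ for all finite $A\subseteq Y_1$, and it is an embedding if it is injective (one-to-one) and $\delta_1(A)=\delta_2(\phi(A))$ for all finite $A\subseteq Y_1$. A diversity $(X,\delta)$ is injective if: given any pair of diversities $(Y_1,\delta_1)$, $(Y_2,\delta_2)$, an embedding $\pi:Y_1\to Y_2$ and a non-expansive map $\phi:Y_1\to X$, there is a non-expansive map $\psi:Y_2\to X$ such that $\phi=\psi\circ\pi$. A diversity $(X,\delta)$ is hyperconvex if for all $r:\mathcal{P}_{\mathrm{fin}}(X)\to\mathbb{R}$ such that $\delta\big(\bigcup_{A\in\mathscr{A}}A\big)\le\sum_{A\in\mathscr{A}}r(A)$ for all finite $\mathscr{A}\subseteq\mathcal{P}_{\mathrm{fin}}(X)$, there is $z\in X$ such that $\delta(\{z\}\cup Y)\le r(Y)$ for all finite $Y\subseteq X$. *)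

theory Defs
  imports Complex_Main "HOL-Library.FuncSet"
begin

text \<open>
  \<^term>\<open>Fpow X\<close> is the set of finite subsets of \<^term>\<open>X\<close>. A diversity on a carrier set
  is a function on all sets of the ambient type; only its values on
  \<^term>\<open>Fpow X\<close> are ever constrained or used.
\<close>

locale diversity =
  fixes X :: "'a set" and \<delta> :: "'a set \<Rightarrow> real"
  assumes nonneg: "A \<in> Fpow X \<Longrightarrow> \<delta> A \<ge> 0"
    and eq_0_iff: "A \<in> Fpow X \<Longrightarrow> \<delta> A = 0 \<longleftrightarrow> card A \<le> 1"
    and triangle: "A \<in> Fpow X \<Longrightarrow> B \<in> Fpow X \<Longrightarrow> C \<in> Fpow X \<Longrightarrow> B \<noteq> {} \<Longrightarrow>
      \<delta> (A \<union> C) \<le> \<delta> (A \<union> B) + \<delta> (B \<union> C)"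

definition nonexpansive ::
    "'a set \<Rightarrow> ('a set \<Rightarrow> real) \<Rightarrow> 'b set \<Rightarrow> ('b set \<Rightarrow> real) \<Rightarrow> ('a \<Rightarrow> 'b) \<Rightarrow> bool" where
  "nonexpansive Y\<^sub>1 \<delta>\<^sub>1 Y\<^sub>2 \<delta>\<^sub>2 \<phi> \<longleftrightarrow>
     \<phi> \<in> Y\<^sub>1 \<rightarrow> Y\<^sub>2 \<and> (\<forall>A\<in>Fpow Y\<^sub>1. \<delta>\<^sub>1 A \<ge> \<delta>\<^sub>2 (\<phi> ` A))"

definition diversity_embedding ::
    "'a set \<Rightarrow> ('a set \<Rightarrow> real) \<Rightarrow> 'b set \<Rightarrow> ('b set \<Rightarrow> real) \<Rightarrow> ('a \<Rightarrow> 'b) \<Rightarrow> bool" where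
  "diversity_embedding Y\<^sub>1 \<delta>\<^sub>1 Y\<^sub>2 \<delta>\<^sub>2 \<pi> \<longleftrightarrow>
     \<pi> \<in> Y\<^sub>1 \<rightarrow> Y\<^sub>2 \<and> inj_on \<pi> Y\<^sub>1 \<and> (\<forall>A\<in>Fpow Y\<^sub>1. \<delta>\<^sub>1 A = \<delta>\<^sub>2 (\<pi> ` A))"

text \<open>
  Injectivity quantifies over all diversities \<open>Y\<^sub>1\<close>, \<open>Y\<^sub>2\<close>. A HOL formula cannot quantify
  over the types of their points, so these types are parameters of the predicate;
  injectivity is the predicate holding at all pairs of types.
\<close>

definition injective_diversity ::
    "'b itself \<Rightarrow> 'c itself \<Rightarrow> 'a set \<Rightarrow> ('a set \<Rightarrow> real) \<Rightarrow> bool" where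
  "injective_diversity T\<^sub>1 T\<^sub>2 X \<delta> \<longleftrightarrow>
     (\<forall>(Y\<^sub>1 :: 'b set) \<delta>\<^sub>1 (Y\<^sub>2 :: 'c set) \<delta>\<^sub>2 \<pi> \<phi>.
        diversity Y\<^sub>1 \<delta>\<^sub>1 \<longrightarrow> diversity Y\<^sub>2 \<delta>\<^sub>2 \<longrightarrow>
        diversity_embedding Y\<^sub>1 \<delta>\<^sub>1 Y\<^sub>2 \<delta>\<^sub>2 \<pi> \<longrightarrow> nonexpansive Y\<^sub>1 \<delta>\<^sub>1 X \<delta> \<phi> \<longrightarrow>
        (\<exists>\<psi>. nonexpansive Y\<^sub>2 \<delta>\<^sub>2 X \<delta> \<psi> \<and> (\<forall>y\<in>Y\<^sub>1. \<phi> y = (\<psi> \<circ> \<pi>) y)))"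

definition hyperconvex_diversity :: "'a set \<Rightarrow> ('a set \<Rightarrow> real) \<Rightarrow> bool" where
  "hyperconvex_diversity X \<delta> \<longleftrightarrow>
     (\<forall>r :: 'a set \<Rightarrow> real.
        (\<forall>\<A>\<in>Fpow (Fpow X). \<delta> (\<Union>\<A>) \<le> (\<Sum>A\<in>\<A>. r A)) \<longrightarrow>
        (\<exists>z\<in>X. \<forall>Y\<in>Fpow X. \<delta> ({z} \<union> Y) \<le> r Y))"

end

theory Submission
  imports Defs
begin

text \<open>
  \<^bold>\<open>Hyperconvex implies injective.\<close> Identify a partial map with its graph. The graphs in
  \<open>Y\<^sub>2 \<times> X\<close> of which every finite part does not expand form a family of finite character,
  and they are automatically single-valued, because two values at one point span a set of
  diversity at most that of a singleton. So Zorn's lemma extends the graph of \<open>\<phi>\<close> along \<open>\<pi>\<close> to a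
  maximal one. It is total: a value \<open>z\<close> at a further point \<open>y\<close> is admissible if and only if
  \<open>\<delta> ({z} \<union> snd ` S) \<le> \<delta>\<^sub>2 ({y} \<union> fst ` S)\<close> for all finite parts \<open>S\<close> of the graph, and
  hyperconvexity provides such a \<open>z\<close>. Hyperconvexity wants one bound for each finite subset of
  \<open>X\<close>, whereas here one set \<open>snd ` S\<close> may have many bounds or none;
  \<open>hyperconvex_indexed\<close> bridges this.

  \<^bold>\<open>Injective implies hyperconvex.\<close> Given bounds \<open>r\<close>, adjoin a new point \<open>\<infinity>\<close> to \<open>X\<close> and let
  the diversity of \<open>{\<infinity>} \<union> Y\<close> be the infimum of the costs of connecting \<open>\<infinity>\<close> with all of \<open>Y\<close>, when
  joining a set \<open>A\<close> to \<open>\<infinity>\<close> costs \<open>r A\<close>, and a set \<open>B\<close> that meets what is already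
  connected can be attached at cost \<open>\<delta> B\<close>. The assumption on \<open>r\<close> says precisely that no detour
  through \<open>\<infinity>\<close> undercuts \<open>\<delta>\<close>. If some point of \<open>X\<close> has cost \<open>0\<close>, it is itself the point sought.
  Otherwise the enlarged space is a diversity that contains \<open>X\<close>, and injectivity retracts it to
  \<open>X\<close>; the image of \<open>\<infinity>\<close> is the point sought.
\<close>

section \<open>Diversities\<close>

context diversity
begin

lemma empty [simp]: "\<delta> {} = 0"
  using eq_0_iff[of "{}"] by (simp add: Fpow_def)

lemma singleton [simp]: "x \<in> X \<Longrightarrow> \<delta> {x} = 0"
  using eq_0_iff[of "{x}"] by (simp add: Fpow_def)

text \<open>
  Enlarging by one point \<open>b\<close> suffices, and there the triangle inequality through \<open>{b}\<close> applies,
  whose second term \<open>\<delta> {b}\<close> vanishes.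
\<close>

lemma mono:
  assumes "B \<in> Fpow X" "A \<subseteq> B"
  shows "\<delta> A \<le> \<delta> B"
proof -
  have "finite B" "B \<subseteq> X" using assms by (auto simp: Fpow_def)
  have "\<delta> A \<le> \<delta> (A \<union> C)" if "finite C" "C \<subseteq> X" for C
    using that
  proof (induction C rule: finite_induct)
    case (insert b C)
    have "\<delta> ((A \<union> C) \<union> {}) \<le> \<delta> ((A \<union> C) \<union> {b}) + \<delta> ({b} \<union> {})"
      using insert.prems insert.hyps \<open>finite B\<close> \<open>B \<subseteq> X\<close> assms(2)
      by (intro triangle) (auto simp: Fpow_def intro: finite_subset)
    then show ?case using insert by simp
  qed simp
  from this[of B] show ?thesis
    using \<open>finite B\<close> \<open>B \<subseteq> X\<close> assms(2) by (simp add: Un_absorb1)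
qed

lemma union_le_if_meet:
  assumes "A \<in> Fpow X" "B \<in> Fpow X" "A \<inter> B \<noteq> {}"
  shows "\<delta> (A \<union> B) \<le> \<delta> A + \<delta> B"
proof -
  have "\<delta> (A \<union> B) \<le> \<delta> (A \<union> (A \<inter> B)) + \<delta> ((A \<inter> B) \<union> B)"
    using assms by (intro triangle) (auto simp: Fpow_def)
  moreover have "A \<union> (A \<inter> B) = A" "(A \<inter> B) \<union> B = B" by auto
  ultimately show ?thesis by simp
qed

lemma pointed_UN_le_sum:
  assumes "finite J" "y \<in> X" "\<And>j. j \<in> J \<Longrightarrow> F j \<in> Fpow X"
  shows "\<delta> (insert y (\<Union>j\<in>J. F j)) \<le> (\<Sum>j\<in>J. \<delta> (insert y (F j)))"
  using assms(1,3)
proof (induction J rule: finite_induct)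
  case (insert i J)
  have "\<delta> (insert y (F i) \<union> insert y (\<Union>j\<in>J. F j))
      \<le> \<delta> (insert y (F i)) + \<delta> (insert y (\<Union>j\<in>J. F j))"
    using insert.prems insert.hyps assms(2)
    by (intro union_le_if_meet) (auto simp: Fpow_def)
  moreover have "insert y (F i) \<union> insert y (\<Union>j\<in>J. F j) = insert y (\<Union>j\<in>insert i J. F j)"
    by auto
  ultimately show ?case using insert by simp
qed (use assms in simp)

end

section \<open>Hyperconvex diversities are injective\<close>

text \<open>
  The bound for a set \<open>A\<close> is the infimum of all \<open>s i\<close> with \<open>F i = A\<close>. For sets that are not of this
  form it must still be finite and respect the assumption of hyperconvexity, which is the
  purpose of the additional candidate \<open>s i0 + \<delta> (A \<union> F i0)\<close> with a fixed nonempty \<open>F i0\<close>.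
  The inequality to be verified is strengthened by an arbitrary finite \<open>J \<subseteq> I\<close>; then the sets
  \<open>A\<close> can be exchanged one after the other for an index, and only one infimum has to be
  estimated at a time.
\<close>

lemma (in diversity) hyperconvex_indexed:
  assumes hyp: "hyperconvex_diversity X \<delta>"
    and F: "\<And>i. i \<in> I \<Longrightarrow> F i \<in> Fpow X"
    and bound: "\<And>J. finite J \<Longrightarrow> J \<subseteq> I \<Longrightarrow> \<delta> (\<Union>j\<in>J. F j) \<le> (\<Sum>j\<in>J. s j)"
  shows "\<exists>z\<in>X. \<forall>i\<in>I. \<delta> (insert z (F i)) \<le> s i"
proof (cases "\<exists>i\<in>I. F i \<noteq> {}")
  case False
  \<comment> \<open>Any point of \<open>X\<close> will do. If \<open>X\<close> were empty, hyperconvexity for the bound \<open>0\<close>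
    would produce a point of it.\<close>
  have "X \<noteq> {}"
  proof
    assume "X = {}"
    then have "\<Union>\<A> = {}" if "\<A> \<in> Fpow (Fpow X)" for \<A>
      using that by (auto simp: Fpow_def)
    then have "\<forall>\<A>\<in>Fpow (Fpow X). \<delta> (\<Union>\<A>) \<le> (\<Sum>A\<in>\<A>. 0)"
      by (metis empty order_refl sum.neutral_const)
    then obtain z where "z \<in> X"
      using hyp unfolding hyperconvex_diversity_def by blast
    with \<open>X = {}\<close> show False by simp
  qed
  then obtain z where "z \<in> X" by blast
  moreover have "s i \<ge> 0" if "i \<in> I" for i
    using bound[of "{i}"] that False by auto
  ultimately show ?thesis using False by (auto intro!: bexI[of _ z])
next
  case True
  then obtain i0 where i0: "i0 \<in> I" "F i0 \<noteq> {}" by blast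
  have s0: "s i \<ge> 0" if "i \<in> I" for i
    using bound[of "{i}"] that nonneg[OF F[OF that]] by auto
  define K where "K A = insert (s i0 + \<delta> (A \<union> F i0)) {s i |i. i \<in> I \<and> F i = A}" for A
  define r where "r A = Inf (K A)" for A
  have K0: "k \<ge> 0" if "k \<in> K A" "A \<in> Fpow X" for k A
    using that s0 i0 F[OF i0(1)] nonneg[of "A \<union> F i0"] by (auto simp: K_def Fpow_def)
  have r_le: "r A \<le> k" if "k \<in> K A" "A \<in> Fpow X" for k A
    unfolding r_def using that K0 by (intro cInf_lower bdd_belowI[of _ 0]) auto
  have key: "\<delta> (\<Union>\<A> \<union> (\<Union>j\<in>J. F j)) \<le> (\<Sum>A\<in>\<A>. r A) + (\<Sum>j\<in>J. s j)"
    if "finite \<A>" "\<A> \<subseteq> Fpow X" "finite J" "J \<subseteq> I" for \<A> J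
    using that
  proof (induction \<A> arbitrary: J rule: finite_induct)
    case empty
    then show ?case using bound by simp
  next
    case (insert A \<A>)
    let ?U = "\<Union>\<A> \<union> (\<Union>j\<in>J. F j)"
    let ?R = "(\<Sum>A\<in>\<A>. r A) + (\<Sum>j\<in>J. s j)"
    have A: "A \<in> Fpow X" using insert.prems by auto
    have "finite (F j) \<and> F j \<subseteq> X" if "j \<in> J" for j
      using F[of j] insert.prems that by (auto simp: Fpow_def)
    then have U: "?U \<in> Fpow X"
      using insert.prems insert.hyps by (auto simp: Fpow_def)
    have via: "\<delta> (?U \<union> F i) \<le> s i + ?R" if i: "i \<in> I" for i
    proof -
      have "\<delta> (\<Union>\<A> \<union> (\<Union>j\<in>insert i J. F j)) \<le> (\<Sum>A\<in>\<A>. r A) + (\<Sum>j\<in>insert i J. s j)"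
        using insert.prems i by (intro insert.IH) auto
      moreover have "(\<Sum>j\<in>insert i J. s j) \<le> s i + (\<Sum>j\<in>J. s j)"
        using insert.prems s0[OF i] by (simp add: sum.insert_if)
      moreover have "\<Union>\<A> \<union> (\<Union>j\<in>insert i J. F j) = ?U \<union> F i" by auto
      ultimately show ?thesis by simp
    qed
    have "\<delta> (A \<union> ?U) - ?R \<le> k" if k: "k \<in> K A" for k
    proof -
      consider i where "i \<in> I" "F i = A" "k = s i" | "k = s i0 + \<delta> (A \<union> F i0)"
        using k by (auto simp: K_def)
      then show ?thesis
      proof cases
        case 1
        then show ?thesis using via[of i] by (simp add: Un_commute Un_left_commute)
      next
        case 2
        have "\<delta> (A \<union> ?U) \<le> \<delta> (A \<union> F i0) + \<delta> (F i0 \<union> ?U)"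
          using A F[OF i0(1)] U i0(2) by (rule triangle)
        moreover have "\<delta> (F i0 \<union> ?U) \<le> s i0 + ?R"
          using via[OF i0(1)] by (simp only: Un_commute)
        ultimately show ?thesis using 2 by linarith
      qed
    qed
    then have "\<delta> (A \<union> ?U) - ?R \<le> r A"
      unfolding r_def by (intro cInf_greatest) (auto simp: K_def)
    then show ?case using insert.hyps by (simp add: Un_assoc)
  qed
  have "\<forall>\<A>\<in>Fpow (Fpow X). \<delta> (\<Union>\<A>) \<le> (\<Sum>A\<in>\<A>. r A)"
    using key[of _ "{}"] by (auto simp: Fpow_def)
  then obtain z where z: "z \<in> X" "\<And>Y. Y \<in> Fpow X \<Longrightarrow> \<delta> ({z} \<union> Y) \<le> r Y"
    using hyp unfolding hyperconvex_diversity_def by blast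
  have "\<delta> (insert z (F i)) \<le> s i" if "i \<in> I" for i
  proof -
    have "s i \<in> K (F i)" using that by (auto simp: K_def)
    then show ?thesis using z(2)[OF F[OF that]] r_le F[OF that] by fastforce
  qed
  with z(1) show ?thesis by blast
qed

text \<open>
  Graphs rather than functions with a domain, because a condition on finite parts passes to
  unions of chains.
\<close>

definition nonexpansive_graph ::
    "'c set \<Rightarrow> ('c set \<Rightarrow> real) \<Rightarrow> 'a set \<Rightarrow> ('a set \<Rightarrow> real) \<Rightarrow> ('c \<times> 'a) set \<Rightarrow> bool" where
  "nonexpansive_graph Y d X \<delta> G \<longleftrightarrow>
     G \<subseteq> Y \<times> X \<and> (\<forall>S\<in>Fpow G. \<delta> (snd ` S) \<le> d (fst ` S))"

lemma nonexpansive_graph_single_valued: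
  assumes X: "diversity X \<delta>" and Y: "diversity Y d" and G: "nonexpansive_graph Y d X \<delta> G"
    and "(y, a) \<in> G" "(y, b) \<in> G"
  shows "a = b"
proof -
  have in_carrier: "y \<in> Y" "a \<in> X" "b \<in> X"
    using G assms(4,5) by (auto simp: nonexpansive_graph_def)
  have "{(y, a), (y, b)} \<in> Fpow G" using assms(4,5) by (auto simp: Fpow_def)
  with G have "\<delta> (snd ` {(y, a), (y, b)}) \<le> d (fst ` {(y, a), (y, b)})"
    unfolding nonexpansive_graph_def by blast
  then have "\<delta> {a, b} \<le> 0"
    using diversity.singleton[OF Y in_carrier(1)] by simp
  moreover have ab: "{a, b} \<in> Fpow X" using in_carrier by (auto simp: Fpow_def)
  ultimately have "\<delta> {a, b} = 0" using diversity.nonneg[OF X ab] by linarith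
  then have "card {a, b} \<le> 1" using diversity.eq_0_iff[OF X ab] by simp
  then show ?thesis by (cases "a = b") auto
qed

lemma nonexpansive_graph_maximal_extension:
  assumes "nonexpansive_graph Y d X \<delta> G0"
  shows "\<exists>G. nonexpansive_graph Y d X \<delta> G \<and> G0 \<subseteq> G \<and>
    (\<forall>p. nonexpansive_graph Y d X \<delta> (insert p G) \<longrightarrow> p \<in> G)"
proof -
  let ?\<G> = "{G. nonexpansive_graph Y d X \<delta> G \<and> G0 \<subseteq> G}"
  have "\<exists>M\<in>?\<G>. \<forall>G\<in>?\<G>. M \<subseteq> G \<longrightarrow> G = M"
  proof (rule subset_Zorn_nonempty)
    show "?\<G> \<noteq> {}" using assms by auto
  next
    fix \<C> assume "\<C> \<noteq> {}" and chain: "subset.chain ?\<G> \<C>"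
    then have sub: "\<C> \<subseteq> ?\<G>" by (auto simp: subset.chain_def)
    have "\<delta> (snd ` S) \<le> d (fst ` S)" if S: "finite S" "S \<subseteq> \<Union>\<C>" for S
    proof -
      obtain G where "G \<in> \<C>" "S \<subseteq> G"
        using finite_subset_Union_chain[OF S \<open>\<C> \<noteq> {}\<close> chain] by blast
      then show ?thesis
        using sub S(1) by (auto simp: nonexpansive_graph_def Fpow_def)
    qed
    then show "\<Union>\<C> \<in> ?\<G>"
      using sub \<open>\<C> \<noteq> {}\<close> unfolding nonexpansive_graph_def Fpow_def by blast
  qed
  then obtain M where M: "M \<in> ?\<G>" and max: "\<forall>G\<in>?\<G>. M \<subseteq> G \<longrightarrow> G = M"
    by (elim bexE)
  have "p \<in> M" if "nonexpansive_graph Y d X \<delta> (insert p M)" for p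
    using bspec[OF max, of "insert p M"] M that by auto
  with M show ?thesis by (intro exI[of _ M]) simp
qed

lemma nonexpansive_graph_extend_point:
  assumes X: "diversity X \<delta>" "hyperconvex_diversity X \<delta>" and Y: "diversity Y d"
    and G: "nonexpansive_graph Y d X \<delta> G" and y: "y \<in> Y"
  shows "\<exists>z. nonexpansive_graph Y d X \<delta> (insert (y, z) G)"
proof -
  have GYX: "G \<subseteq> Y \<times> X" using G by (simp add: nonexpansive_graph_def)
  have fst_in: "fst ` S \<in> Fpow Y" and snd_in: "snd ` S \<in> Fpow X" if "S \<in> Fpow G" for S
    using that GYX by (auto simp: Fpow_def)
  have "\<exists>z\<in>X. \<forall>S\<in>Fpow G. \<delta> (insert z (snd ` S)) \<le> d (insert y (fst ` S))"
  proof (rule diversity.hyperconvex_indexed[OF X snd_in])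
    fix J assume J: "finite J" "J \<subseteq> Fpow G"
    then have UJ: "\<Union>J \<in> Fpow G" by (auto simp: Fpow_def)
    have "\<delta> (snd ` \<Union>J) \<le> d (fst ` \<Union>J)"
      using G UJ by (simp add: nonexpansive_graph_def)
    also have "\<dots> \<le> d (insert y (fst ` \<Union>J))"
      using y fst_in[OF UJ] by (intro diversity.mono[OF Y]) (auto simp: Fpow_def)
    also have "\<dots> \<le> (\<Sum>S\<in>J. d (insert y (fst ` S)))"
      using diversity.pointed_UN_le_sum[OF Y J(1) y, of "\<lambda>S. fst ` S"] J(2) fst_in
      by (auto simp: image_Union)
    finally show "\<delta> (\<Union>S\<in>J. snd ` S) \<le> (\<Sum>S\<in>J. d (insert y (fst ` S)))"
      by (simp add: image_Union)
  qed
  then obtain z where z: "z \<in> X"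
    "\<And>S. S \<in> Fpow G \<Longrightarrow> \<delta> (insert z (snd ` S)) \<le> d (insert y (fst ` S))" by blast
  have "\<delta> (snd ` S) \<le> d (fst ` S)" if S: "S \<in> Fpow (insert (y, z) G)" for S
  proof (cases "(y, z) \<in> S")
    case True
    then have "S = insert (y, z) (S - {(y, z)})" by blast
    then have "snd ` S = insert z (snd ` (S - {(y, z)}))"
        and "fst ` S = insert y (fst ` (S - {(y, z)}))"
      by (metis image_insert snd_conv, metis image_insert fst_conv)
    moreover have "S - {(y, z)} \<in> Fpow G" using S by (auto simp: Fpow_def)
    ultimately show ?thesis using z(2) by simp
  next
    case False
    then have "S \<in> Fpow G" using S by (auto simp: Fpow_def)
    then show ?thesis using G by (simp add: nonexpansive_graph_def)
  qed
  then show ?thesis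
    using GYX y z(1) by (intro exI[of _ z]) (auto simp: nonexpansive_graph_def)
qed

theorem hyperconvex_imp_injective:
  fixes X :: "'a set"
  assumes X: "diversity X \<delta>" "hyperconvex_diversity X \<delta>"
  shows "injective_diversity TYPE('b) TYPE('c) X \<delta>"
  unfolding injective_diversity_def
proof (intro allI impI)
  fix Y\<^sub>1 :: "'b set" and \<delta>\<^sub>1 and Y\<^sub>2 :: "'c set" and \<delta>\<^sub>2 \<pi> \<phi>
  assume "diversity Y\<^sub>1 \<delta>\<^sub>1" and Y2: "diversity Y\<^sub>2 \<delta>\<^sub>2"
    and pi: "diversity_embedding Y\<^sub>1 \<delta>\<^sub>1 Y\<^sub>2 \<delta>\<^sub>2 \<pi>" and phi: "nonexpansive Y\<^sub>1 \<delta>\<^sub>1 X \<delta> \<phi>"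
  let ?G0 = "(\<lambda>y. (\<pi> y, \<phi> y)) ` Y\<^sub>1"
  have "nonexpansive_graph Y\<^sub>2 \<delta>\<^sub>2 X \<delta> ?G0"
    unfolding nonexpansive_graph_def
  proof (intro conjI ballI)
    show "?G0 \<subseteq> Y\<^sub>2 \<times> X"
      using pi phi by (auto simp: diversity_embedding_def nonexpansive_def)
    fix S assume "S \<in> Fpow ?G0"
    then have "finite S" "S \<subseteq> ?G0" by (auto simp: Fpow_def)
    then obtain A where "A \<in> Fpow Y\<^sub>1" "S = (\<lambda>y. (\<pi> y, \<phi> y)) ` A"
      unfolding Fpow_def using finite_subset_image by blast
    then show "\<delta> (snd ` S) \<le> \<delta>\<^sub>2 (fst ` S)"
      using pi phi by (simp add: diversity_embedding_def nonexpansive_def image_image)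
  qed
  from nonexpansive_graph_maximal_extension[OF this]
  obtain G where G: "nonexpansive_graph Y\<^sub>2 \<delta>\<^sub>2 X \<delta> G" "?G0 \<subseteq> G"
    and max: "\<forall>p. nonexpansive_graph Y\<^sub>2 \<delta>\<^sub>2 X \<delta> (insert p G) \<longrightarrow> p \<in> G"
    by (elim exE conjE)
  have "\<forall>y\<in>Y\<^sub>2. \<exists>z. (y, z) \<in> G"
    using nonexpansive_graph_extend_point[OF X Y2 G(1)] max by blast
  then obtain \<psi> where psi: "\<And>y. y \<in> Y\<^sub>2 \<Longrightarrow> (y, \<psi> y) \<in> G" by metis
  show "\<exists>\<psi>. nonexpansive Y\<^sub>2 \<delta>\<^sub>2 X \<delta> \<psi> \<and> (\<forall>y\<in>Y\<^sub>1. \<phi> y = (\<psi> \<circ> \<pi>) y)"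
  proof (intro exI conjI ballI)
    show "nonexpansive Y\<^sub>2 \<delta>\<^sub>2 X \<delta> \<psi>"
      unfolding nonexpansive_def
    proof (intro conjI ballI)
      show "\<psi> \<in> Y\<^sub>2 \<rightarrow> X" using psi G(1) by (auto simp: nonexpansive_graph_def)
      fix A assume "A \<in> Fpow Y\<^sub>2"
      then have "(\<lambda>y. (y, \<psi> y)) ` A \<in> Fpow G" using psi by (auto simp: Fpow_def)
      then have "\<delta> (snd ` (\<lambda>y. (y, \<psi> y)) ` A) \<le> \<delta>\<^sub>2 (fst ` (\<lambda>y. (y, \<psi> y)) ` A)"
        using G(1) unfolding nonexpansive_graph_def by blast
      then show "\<delta> (\<psi> ` A) \<le> \<delta>\<^sub>2 A" by (simp add: image_image)
    qed
    fix y assume "y \<in> Y\<^sub>1"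
    then have "(\<pi> y, \<phi> y) \<in> G" "(\<pi> y, \<psi> (\<pi> y)) \<in> G"
      using G(2) psi pi by (auto simp: diversity_embedding_def)
    then show "\<phi> y = (\<psi> \<circ> \<pi>) y"
      using nonexpansive_graph_single_valued[OF X(1) Y2 G(1)] by simp
  qed
qed

section \<open>Injective diversities are hyperconvex\<close>

locale admissible_bound = diversity +
  fixes r :: "'a set \<Rightarrow> real"
  assumes cover: "\<A> \<in> Fpow (Fpow X) \<Longrightarrow> \<delta> (\<Union>\<A>) \<le> (\<Sum>A\<in>\<A>. r A)"
begin

text \<open>
  Connections of a finite set to the new point, with their cost. The rule \<open>part\<close> lets a
  connection pass through points outside the set to be connected; it makes the
  infimal cost monotone.
\<close>

inductive joined :: "'a set \<Rightarrow> real \<Rightarrow> bool" where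
  nothing: "joined {} 0"
| spoke: "joined Y c \<Longrightarrow> A \<in> Fpow X \<Longrightarrow> joined (Y \<union> A) (c + r A)"
| attach: "joined Y c \<Longrightarrow> B \<in> Fpow X \<Longrightarrow> Y \<inter> B \<noteq> {} \<Longrightarrow> joined (Y \<union> B) (c + \<delta> B)"
| part: "joined Y c \<Longrightarrow> Z \<subseteq> Y \<Longrightarrow> joined Z c"

lemma joined_Fpow: "joined Y c \<Longrightarrow> Y \<in> Fpow X"
  by (induction rule: joined.induct) (auto simp: Fpow_def intro: finite_subset)

lemma joined_Un:
  assumes "joined Y c" "joined Z e"
  shows "joined (Y \<union> Z) (c + e)"
  using assms(2)
proof induction
  case nothing
  then show ?case using assms(1) by simp
next
  case (spoke Z e A)
  then show ?case using joined.spoke[OF spoke.IH] by (simp add: Un_assoc add.assoc)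
next
  case (attach Z e B)
  then have "(Y \<union> Z) \<inter> B \<noteq> {}" by blast
  then show ?case
    using joined.attach[OF attach.IH attach.hyps(2)] by (simp add: Un_assoc add.assoc)
next
  case (part Z e W)
  then show ?case using joined.part[OF part.IH, of "Y \<union> W"] by blast
qed

text \<open>
  Connecting through the new point is never cheaper than \<open>\<delta>\<close>. The family \<open>\<A>\<close> makes the
  induction work: a spoke to \<open>A\<close> becomes a further member of the family, and the empty connection
  is the assumption on \<open>r\<close>.
\<close>

lemma diversity_le_joined:
  assumes "joined Y c" "finite \<A>" "\<A> \<subseteq> Fpow X"
  shows "\<delta> (Y \<union> \<Union>\<A>) \<le> c + (\<Sum>A\<in>\<A>. r A)"
  using assms
proof (induction arbitrary: \<A> rule: joined.induct)
  case nothing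
  then show ?case using cover[of \<A>] by (simp add: Fpow_def)
next
  case (spoke Y c A)
  have "r A \<ge> 0" using cover[of "{A}"] nonneg[of A] spoke.hyps by (auto simp: Fpow_def)
  then have "(\<Sum>A\<in>insert A \<A>. r A) \<le> r A + (\<Sum>A\<in>\<A>. r A)"
    using spoke.prems by (simp add: sum.insert_if)
  moreover have "\<delta> (Y \<union> \<Union>(insert A \<A>)) \<le> c + (\<Sum>A\<in>insert A \<A>. r A)"
    using spoke by (intro spoke.IH) auto
  ultimately show ?case by (simp add: Un_assoc)
next
  case (attach Y c B)
  have "Y \<union> \<Union>\<A> \<in> Fpow X"
    using joined_Fpow[OF attach.hyps(1)] attach.prems by (auto simp: Fpow_def)
  then have "\<delta> ((Y \<union> \<Union>\<A>) \<union> B) \<le> \<delta> (Y \<union> \<Union>\<A>) + \<delta> B"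
    using attach.hyps by (intro union_le_if_meet) auto
  moreover have "(Y \<union> \<Union>\<A>) \<union> B = Y \<union> B \<union> \<Union>\<A>" by blast
  ultimately show ?case using attach.IH[OF attach.prems] by simp
next
  case (part Y c Z)
  have "\<delta> (Z \<union> \<Union>\<A>) \<le> \<delta> (Y \<union> \<Union>\<A>)"
    using joined_Fpow[OF part.hyps(1)] part.hyps(2) part.prems
    by (intro mono) (auto simp: Fpow_def)
  then show ?case using part.IH[OF part.prems] by simp
qed

definition cost :: "'a set \<Rightarrow> real" where
  "cost Y = Inf {c. joined Y c}"

lemma joined_nonneg: "joined Y c \<Longrightarrow> c \<ge> 0"
  using diversity_le_joined[of Y c "{}"] nonneg[OF joined_Fpow] by fastforce

lemma cost_le: "joined Y c \<Longrightarrow> cost Y \<le> c"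
  unfolding cost_def by (intro cInf_lower bdd_belowI[of _ 0]) (auto intro: joined_nonneg)

lemma le_costI:
  assumes "Y \<in> Fpow X" "\<And>c. joined Y c \<Longrightarrow> b \<le> c"
  shows "b \<le> cost Y"
  unfolding cost_def
  using joined.spoke[OF joined.nothing assms(1)] assms(2) by (intro cInf_greatest) auto

lemma cost_nonneg: "Y \<in> Fpow X \<Longrightarrow> cost Y \<ge> 0"
  by (intro le_costI joined_nonneg)

lemma cost_empty [simp]: "cost {} = 0"
  using cost_le[OF joined.nothing] cost_nonneg[of "{}"] by (simp add: Fpow_def)

lemma cost_le_bound: "Y \<in> Fpow X \<Longrightarrow> cost Y \<le> r Y"
  using cost_le[OF joined.spoke[OF joined.nothing]] by simp

lemma diversity_le_cost: "Y \<in> Fpow X \<Longrightarrow> \<delta> Y \<le> cost Y"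
  using diversity_le_joined[of Y _ "{}"] by (intro le_costI) auto

lemma cost_mono: "Y \<in> Fpow X \<Longrightarrow> Z \<subseteq> Y \<Longrightarrow> cost Z \<le> cost Y"
  by (intro le_costI cost_le) (auto intro: joined.part)

lemma cost_Un_le:
  assumes "Y \<in> Fpow X" "Z \<in> Fpow X"
  shows "cost (Y \<union> Z) \<le> cost Y + cost Z"
proof -
  have "cost (Y \<union> Z) - cost Z \<le> c" if c: "joined Y c" for c
  proof -
    have "cost (Y \<union> Z) - c \<le> cost Z"
      using assms(2)
    proof (rule le_costI)
      fix e assume "joined Z e"
      then show "cost (Y \<union> Z) - c \<le> e" using cost_le[OF joined_Un[OF c]] by force
    qed
    then show ?thesis by simp
  qed
  then have "cost (Y \<union> Z) - cost Z \<le> cost Y" using assms(1) by (intro le_costI)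
  then show ?thesis by simp
qed

lemma cost_attach_le:
  assumes "Y \<in> Fpow X" "B \<in> Fpow X" "Y \<inter> B \<noteq> {}"
  shows "cost (Y \<union> B) \<le> cost Y + \<delta> B"
proof -
  have "cost (Y \<union> B) - \<delta> B \<le> cost Y"
    using assms(1)
  proof (rule le_costI)
    fix c assume "joined Y c"
    then show "cost (Y \<union> B) - \<delta> B \<le> c"
      using cost_le[OF joined.attach[OF _ assms(2,3)]] by force
  qed
  then show ?thesis by simp
qed

definition adjoin :: "'a option set \<Rightarrow> real" where
  "adjoin S = (if None \<in> S then cost (Some -` S) else \<delta> (Some -` S))"

text \<open>
  Which case of the triangle inequality arises depends on the sets that contain \<open>None\<close>. If
  only \<open>A\<close> or only \<open>C\<close> contains it, \<open>B\<close> is a nonempty set of old points, where the other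
  set can be attached. If \<open>B\<close> alone contains it, the two connections together cover \<open>A \<union> C\<close>,
  which therefore costs at least \<open>\<delta>\<close>.
\<close>

lemma diversity_adjoin:
  assumes pos: "\<And>x. x \<in> X \<Longrightarrow> cost {x} \<noteq> 0"
  shows "diversity (insert None (Some ` X)) adjoin"
proof -
  let ?Z = "insert None (Some ` X)"
  have Some_vimage: "Some -` S \<in> Fpow X" if "S \<in> Fpow ?Z" for S
    using that by (auto simp: Fpow_def intro: finite_vimageI)
  show ?thesis
  proof
    fix A assume "A \<in> Fpow ?Z"
    then show "adjoin A \<ge> 0" using Some_vimage nonneg cost_nonneg by (simp add: adjoin_def)
  next
    fix A assume A: "A \<in> Fpow ?Z"
    let ?A = "Some -` A"
    have A': "finite ?A" "?A \<subseteq> X" "?A \<in> Fpow X" using Some_vimage[OF A] by (auto simp: Fpow_def)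
    show "adjoin A = 0 \<longleftrightarrow> card A \<le> 1"
    proof (cases "None \<in> A")
      case True
      then have eq: "A = insert None (Some ` ?A)" by (auto simp: image_iff)
      have "card A = Suc (card ?A)"
        using arg_cong[OF eq, of card] A'(1) by (simp add: card_image del: image_vimage_eq)
      moreover have "cost ?A = 0 \<longleftrightarrow> ?A = {}"
      proof
        assume "cost ?A = 0"
        show "?A = {}"
        proof (rule ccontr)
          assume "?A \<noteq> {}"
          then obtain x where x: "x \<in> ?A" by blast
          then have "cost {x} \<le> 0" using cost_mono[OF A'(3), of "{x}"] \<open>cost ?A = 0\<close> by auto
          moreover have "cost {x} \<ge> 0" using x A'(2) by (intro cost_nonneg) (auto simp: Fpow_def)
          ultimately show False using pos[of x] x A'(2) by auto
        qed
      qed simp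
      ultimately show ?thesis using True A'(1) by (simp add: adjoin_def)
    next
      case False
      then have eq: "A = Some ` ?A" by (auto simp: image_iff) (metis option.exhaust)
      have "card A = card ?A" using arg_cong[OF eq, of card] by (simp add: card_image del: image_vimage_eq)
      then show ?thesis using False eq_0_iff[OF A'(3)] by (simp add: adjoin_def)
    qed
  next
    fix A B C assume ABC: "A \<in> Fpow ?Z" "B \<in> Fpow ?Z" "C \<in> Fpow ?Z" and "B \<noteq> {}"
    let ?A = "Some -` A" and ?B = "Some -` B" and ?C = "Some -` C"
    have in_X: "?A \<in> Fpow X" "?B \<in> Fpow X" "?C \<in> Fpow X"
      "?A \<union> ?B \<in> Fpow X" "?B \<union> ?C \<in> Fpow X" "?A \<union> ?C \<in> Fpow X"
      using Some_vimage[OF ABC(1)] Some_vimage[OF ABC(2)] Some_vimage[OF ABC(3)] by (auto simp: Fpow_def)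
    have both: "cost (?A \<union> ?C) \<le> cost (?A \<union> ?B) + cost (?B \<union> ?C)"
      using cost_Un_le[OF in_X(1,3)] cost_mono[OF in_X(4), of ?A] cost_mono[OF in_X(5), of ?C]
      by simp
    have one: "cost (U \<union> W) \<le> cost (U \<union> ?B) + \<delta> (?B \<union> W)"
      if UW: "U \<in> Fpow X" "W \<in> Fpow X" and "?B \<noteq> {}" for U W
    proof -
      have "cost (U \<union> W) \<le> cost ((U \<union> ?B) \<union> (?B \<union> W))"
        using UW in_X(2) by (intro cost_mono) (auto simp: Fpow_def)
      also have "\<dots> \<le> cost (U \<union> ?B) + \<delta> (?B \<union> W)"
        using UW in_X(2) \<open>?B \<noteq> {}\<close> by (intro cost_attach_le) (auto simp: Fpow_def)
      finally show ?thesis .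
    qed
    have B: "None \<in> B \<or> ?B \<noteq> {}"
      using \<open>B \<noteq> {}\<close> by (auto simp: vimage_def) (metis option.exhaust)
    show "adjoin (A \<union> C) \<le> adjoin (A \<union> B) + adjoin (B \<union> C)"
    proof (cases "None \<in> B \<or> None \<in> A \<and> None \<in> C")
      case True
      \<comment> \<open>Both sets on the right contain the new point.\<close>
      then show ?thesis
        using both diversity_le_cost[OF in_X(6)] by (auto simp: adjoin_def)
    next
      case False
      then have "?B \<noteq> {}" using B by blast
      then show ?thesis
        using False one[OF in_X(1,3)] one[OF in_X(3,1)] triangle[OF in_X(1-3)]
        by (auto simp: adjoin_def Un_commute)
    qed
  qed
qed

end

text \<open>
  The case distinction is needed because two distinct points of a diversity never have
  diversity \<open>0\<close>: when connecting \<open>x\<close> is free, the new point would have to coincide with \<open>x\<close>.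
\<close>

lemma (in diversity) injective_imp_hyperconvex:
  assumes inj: "injective_diversity TYPE('a) TYPE('a option) X \<delta>"
  shows "hyperconvex_diversity X \<delta>"
  unfolding hyperconvex_diversity_def
proof (intro allI impI)
  fix r :: "'a set \<Rightarrow> real"
  assume "\<forall>\<A>\<in>Fpow (Fpow X). \<delta> (\<Union>\<A>) \<le> (\<Sum>A\<in>\<A>. r A)"
  then interpret admissible_bound X \<delta> r by unfold_locales blast
  have "\<exists>z\<in>X. \<forall>Y\<in>Fpow X. \<delta> ({z} \<union> Y) \<le> cost Y"
  proof (cases "\<exists>x\<in>X. cost {x} = 0")
    case True
    then obtain x where x: "x \<in> X" "cost {x} = 0" by blast
    have "\<delta> ({x} \<union> Y) \<le> cost Y" if "Y \<in> Fpow X" for Y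
      using diversity_le_cost[of "{x} \<union> Y"] cost_Un_le[of "{x}" Y] x that
      by (auto simp: Fpow_def)
    with x(1) show ?thesis by blast
  next
    case False
    then have "diversity (insert None (Some ` X)) adjoin" by (intro diversity_adjoin) auto
    moreover have "diversity_embedding X \<delta> (insert None (Some ` X)) adjoin Some"
      by (auto simp: diversity_embedding_def adjoin_def inj_vimage_image_eq)
    moreover have "nonexpansive X \<delta> X \<delta> (\<lambda>x. x)"
      by (auto simp: nonexpansive_def)
    ultimately obtain \<psi> where
      psi: "nonexpansive (insert None (Some ` X)) adjoin X \<delta> \<psi>" "\<And>x. x \<in> X \<Longrightarrow> \<psi> (Some x) = x"
      using inj diversity_axioms unfolding injective_diversity_def by (metis comp_apply)
    have "\<delta> ({\<psi> None} \<union> Y) \<le> cost Y" if Y: "Y \<in> Fpow X" for Y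
    proof -
      have "insert None (Some ` Y) \<in> Fpow (insert None (Some ` X))"
        using Y by (auto simp: Fpow_def)
      then have "\<delta> (\<psi> ` insert None (Some ` Y)) \<le> adjoin (insert None (Some ` Y))"
        using psi(1) unfolding nonexpansive_def by blast
      moreover have "(\<lambda>x. \<psi> (Some x)) ` Y = Y"
        using Y psi(2) by (force simp: Fpow_def)
      moreover have "Some -` insert None (Some ` Y) = Y" by auto
      ultimately show ?thesis by (simp add: adjoin_def image_image)
    qed
    moreover have "\<psi> None \<in> X" using psi(1) by (auto simp: nonexpansive_def)
    ultimately show ?thesis by blast
  qed
  then show "\<exists>z\<in>X. \<forall>Y\<in>Fpow X. \<delta> ({z} \<union> Y) \<le> r Y"
    using cost_le_bound by (meson order_trans)
qed

theorem theorem3p3: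
  fixes X :: "'a set" and \<delta> :: "'a set \<Rightarrow> real"
  assumes "diversity X \<delta>"
  shows "(injective_diversity TYPE('a) TYPE('a option) X \<delta> \<longleftrightarrow> hyperconvex_diversity X \<delta>) \<and>
         (hyperconvex_diversity X \<delta> \<longrightarrow> injective_diversity TYPE('b) TYPE('c) X \<delta>)"
  by (intro conjI iffI impI)
    (use assms in \<open>simp_all add: diversity.injective_imp_hyperconvex hyperconvex_imp_injective\<close>)

end
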